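(* Let $a,b$ be positive integers such that $a$ is coprime to $b$ and $a>b$. Then, as polynomials in the indeterminate $X$ with integer coefficients, $$X^{ab}-1 = (X^{a}-1)\Big(\sum_{i= 0}^{b-1}X^{i}\Big)\Big(1+(X-1)\sum_{i=0}^{b-1}\sum_{j=1}^{\lfloor ai/b\rfloor}X^{ai - bj}\Big).$$
   Context: $\lfloor x\rfloor$ denotes the floor of $x$; an inner sum whose upper limit is $0$ is empty (equal to $0$). *)

theory Defs
  imports "HOL-Computational_Algebra.Polynomial"
begin

abbreviation X :: "int poly" where
  "X \<equiv> [:0, 1:]"

end

theory Submission
  imports Defs "HOL-Number_Theory.Cong"
begin

text \<open>
  Write \<open>a * i = b * q + r\<close> with \<open>r = a * i mod b\<close>. Multiplying the inner sum by \<open>X ^ b - 1\<close>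
  telescopes to \<open>X ^ (a * i) - X ^ r\<close>, and as \<open>i\<close> runs through the residues modulo \<open>b\<close> so does
  \<open>r\<close>. Since \<open>X - 1\<close> times the sum of the \<open>X ^ i\<close> is \<open>X ^ b - 1\<close>, the product of the last two
  factors collapses to the sum of the \<open>X ^ (a * i)\<close>, a geometric sum in \<open>X ^ a\<close>.
\<close>

lemma sum_power_arith_telescope:
  fixes x :: "'a::comm_ring_1"
  assumes "b * q \<le> n"
  shows "(x ^ b - 1) * (\<Sum>j=1..q. x ^ (n - b * j)) = x ^ n - x ^ (n - b * q)"
  using assms
proof (induction q)
  case 0
  then show ?case by simp
next
  case (Suc q)
  \<comment> \<open>As \<open>b * Suc q \<le> n\<close>, no subtraction truncates:
    \<open>x ^ b\<close> times the new term is the old tail, which cancels.\<close>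
  then have "n - b * q = b + (n - b * Suc q)" and "b * q \<le> n"
    by auto
  then have "x ^ b * x ^ (n - b * Suc q) = x ^ (n - b * q)"
    by (simp only: power_add)
  with Suc.IH \<open>b * q \<le> n\<close> show ?case
    by (simp add: distrib_left left_diff_distrib)
qed

text \<open>Coprimality lets \<open>a\<close> be cancelled modulo \<open>b\<close>; an injective
  self-map of a finite set is onto.\<close>

lemma bij_betw_mult_mod:
  fixes a b :: nat
  assumes "b > 0" and "coprime a b"
  shows "bij_betw (\<lambda>i. a * i mod b) {..<b} {..<b}"
proof -
  have inj: "inj_on (\<lambda>i. a * i mod b) {..<b}"
  proof (rule inj_onI)
    fix i j
    assume "i \<in> {..<b}" "j \<in> {..<b}" "a * i mod b = a * j mod b"
    then have "[i = j] (mod b)"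
      unfolding cong_def [symmetric] using assms(2) by (simp only: cong_mult_lcancel_nat)
    with \<open>i \<in> {..<b}\<close> \<open>j \<in> {..<b}\<close> show "i = j"
      by (simp add: cong_def)
  qed
  moreover have "(\<lambda>i. a * i mod b) ` {..<b} \<subseteq> {..<b}"
    using assms(1) by auto
  ultimately have "(\<lambda>i. a * i mod b) ` {..<b} = {..<b}"
    by (intro endo_inj_surj) simp_all
  with inj show ?thesis
    unfolding bij_betw_def by blast
qed

lemma power_mult_minus_one_factorization:
  fixes x :: "'a::comm_ring_1"
  assumes "b > 0" and "coprime a b"
  shows "x ^ (a * b) - 1 = (x ^ a - 1) * (\<Sum>i<b. x ^ i) *
    (1 + (x - 1) * (\<Sum>i<b. \<Sum>j=1..a * i div b. x ^ (a * i - b * j)))"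
    (is "_ = _ * ?T * (1 + _ * ?S)")
proof -
  have "(x ^ b - 1) * ?S = (\<Sum>i<b. x ^ (a * i) - x ^ (a * i mod b))"
    unfolding sum_distrib_left [of "x ^ b - 1" _ "{..<b}"]
    by (intro sum.cong refl, subst sum_power_arith_telescope)
      (simp_all add: minus_mult_div_eq_mod)
  also have "\<dots> = (\<Sum>i<b. x ^ (a * i)) - ?T"
    using sum.reindex_bij_betw [OF bij_betw_mult_mod [OF assms], of "\<lambda>r. x ^ r"]
    by (simp add: sum_subtractf)
  finally have S: "(x ^ b - 1) * ?S = (\<Sum>i<b. x ^ (a * i)) - ?T" .
  have "?T * (1 + (x - 1) * ?S) = ?T + (x - 1) * ?T * ?S"
    by (simp only: distrib_left mult_1_left mult_1_right ac_simps)
  also have "\<dots> = (\<Sum>i<b. (x ^ a) ^ i)"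
    \<comment> \<open>\<open>(x - 1) * ?T\<close> folds to \<open>x ^ b - 1\<close>, so
      \<open>S\<close> applies and \<open>?T\<close> cancels.\<close>
    unfolding power_diff_1_eq [symmetric] S by (simp add: power_mult)
  finally show ?thesis
    unfolding power_mult power_diff_1_eq [of "x ^ a" b] by (simp only: mult.assoc)
qed

theorem theorem1:
  fixes a b :: nat
  assumes "a > 0" and "b > 0" and "coprime a b" and "a > b"
  shows "X ^ (a * b) - 1 =
    (X ^ a - 1) * (\<Sum>i=0..b - 1. X ^ i) *
    (1 + (X - 1) * (\<Sum>i=0..b - 1. \<Sum>j=1..nat \<lfloor>real (a * i) / real b\<rfloor>. X ^ (a * i - b * j)))"
proof -
  \<comment> \<open>Fails for \<open>b = 0\<close>, where \<open>b - 1\<close> truncates to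
    \<open>0\<close>.\<close>
  have "{0..b - 1} = {..<b}"
    using \<open>b > 0\<close> by auto
  moreover have "nat \<lfloor>real (a * i) / real b\<rfloor> = a * i div b" for i
    by (simp only: floor_divide_of_nat_eq nat_int)
  ultimately show ?thesis
    using power_mult_minus_one_factorization [OF assms(2,3), of X] by (simp only:)
qed

end
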